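(* Suppose $h:(0,\infty)\to(0,\infty)$ is a log convex function such that $\lim_{n\to\infty}\dfrac{h(n)}{h(n+1)}=1$ (limit over positive integers $n$) and such that the function $x\mapsto \dfrac{h(x)^2}{h(2x)}$ is integrable on $(0,\infty)$. Then $h$ is integrable on $(0,\infty)$.
   Context: A function $h:(0,\infty)\to(0,\infty)$ is log convex if $\log h$ is a convex function on $(0,\infty)$. Integrable on $(0,\infty)$ means belonging to $L^1((0,\infty))$ with respect to Lebesgue measure. *)

theory Defs
  imports "HOL-Analysis.Analysis"
begin

(* Meant for functions that are positive on S: ln is not the logarithm at nonpositive arguments. *)
definition log_convex_on :: "real set \<Rightarrow> (real \<Rightarrow> real) \<Rightarrow> bool" where
  "log_convex_on S h \<longleftrightarrow> convex_on S (\<lambda>x. ln (h x))"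

end

(* Log convexity makes the slopes of ln h nondecreasing, and the ratio condition makes them tend
   to 0 along the integers, so ln h has no positive slope and h is nonincreasing. Hence
   h(2x) <= h(x), so h(x) <= h(x)^2 / h(2x), and the hypothesis dominates h. *)
theory Submission
  imports Defs
begin

text \<open>The slope of the chord over \<open>[x, z]\<close> lies between those over
  \<open>[x, y]\<close> and \<open>[y, z]\<close>; transitivity through it gives the claim, up to
  reversing signs in numerators and denominators.\<close>

lemma convex_on_slope_mono:
  fixes f :: "real \<Rightarrow> real"
  assumes "convex_on I f" "x \<in> I" "y \<in> I" "z \<in> I" "x < y" "y < z"
  shows "(f y - f x) / (y - x) \<le> (f z - f y) / (z - y)"
  using order_trans[OF convex_on_slope_le[OF assms(1,2,4-6)]]
  by (metis minus_diff_eq minus_divide_divide)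

lemma convex_on_increments_tendsto_0_imp_antimono:
  fixes f :: "real \<Rightarrow> real"
  assumes f: "convex_on {0<..} f"
    and lim: "(\<lambda>n::nat. f (real (n + 1)) - f (real n)) \<longlonglongrightarrow> 0"
    and xy: "0 < x" "x < y"
  shows "f y \<le> f x"
proof -
  have "eventually (\<lambda>n::nat. y < real n) sequentially"
    using eventually_gt_at_top[of "nat \<lceil>y\<rceil>"] by eventually_elim linarith
  \<comment> \<open>Once \<open>n\<close> passes \<open>y\<close>, the intervals
    \<open>[x, y]\<close>, \<open>[y, n]\<close>, \<open>[n, n + 1]\<close> are adjacent, so their
    slopes increase; the last has length 1, so its slope is the plain increment.\<close>
  then have "eventually (\<lambda>n. (f y - f x) / (y - x) \<le> f (real (n + 1)) - f (real n)) sequentially"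
  proof eventually_elim
    case (elim n)
    have "(f y - f x) / (y - x) \<le> (f (real n) - f y) / (real n - y)"
      using convex_on_slope_mono[OF f, of x y "real n"] xy elim by simp
    also have "\<dots> \<le> (f (real (n + 1)) - f (real n)) / (real (n + 1) - real n)"
      using convex_on_slope_mono[OF f, of y "real n" "real (n + 1)"] xy elim by simp
    finally show ?case by simp
  qed
  then have "(f y - f x) / (y - x) \<le> 0"
    by (rule tendsto_lowerbound[OF lim]) simp
  then show ?thesis
    using xy by (simp add: divide_le_0_iff)
qed

text \<open>Supplies the measurability of \<open>h\<close>. Openness matters because a convex
  function may jump at an endpoint; positivity lets \<open>exp\<close> undo
  \<open>ln\<close>.\<close>

lemma log_convex_on_imp_continuous_on:
  assumes "open S" "log_convex_on S h" "\<And>x. x \<in> S \<Longrightarrow> h x > 0"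
  shows "continuous_on S h"
proof -
  have "continuous_on S (\<lambda>x. exp (ln (h x)))"
    using assms by (intro continuous_on_exp convex_on_continuous) (simp_all add: log_convex_on_def)
  then show ?thesis
    using assms(3) by (simp cong: continuous_on_cong)
qed

theorem theorem2:
  fixes h :: "real \<Rightarrow> real"
  assumes pos: "\<And>x. x > 0 \<Longrightarrow> h x > 0"
    and log_convex: "log_convex_on {0<..} h"
    and lim: "(\<lambda>n::nat. h (real n) / h (real (n + 1))) \<longlonglongrightarrow> 1"
    and int: "(\<lambda>x. (h x)\<^sup>2 / h (2 * x)) absolutely_integrable_on {0<..}"
  shows "h absolutely_integrable_on {0<..}"
proof (rule measurable_bounded_by_integrable_imp_absolutely_integrable)
  show "h \<in> borel_measurable (lebesgue_on {0<..})"
    using log_convex pos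
    by (intro continuous_imp_measurable_on_sets_lebesgue log_convex_on_imp_continuous_on) auto
  show "{0<..} \<in> sets (lebesgue :: real measure)"
    by simp
  show "(\<lambda>x. (h x)\<^sup>2 / h (2 * x)) integrable_on {0<..}"
    using int by (rule set_lebesgue_integral_eq_integral(1))
next
  fix x :: real
  assume "x \<in> {0<..}"
  then have x: "x > 0" by simp
  \<comment> \<open>The hypothesis has \<open>h n\<close> in the numerator, so the forward increment
    of \<open>ln h\<close> is minus the logarithm of the ratio.\<close>
  have "(\<lambda>n::nat. - ln (h (real n) / h (real (n + 1)))) \<longlonglongrightarrow> 0"
    using tendsto_minus[OF tendsto_ln[OF lim]] by simp
  moreover have "eventually (\<lambda>n::nat. - ln (h (real n) / h (real (n + 1)))
      = ln (h (real (n + 1))) - ln (h (real n))) sequentially"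
    \<comment> \<open>Nothing is known about \<open>h 0\<close>, so splitting the logarithm of the
      quotient needs \<open>n > 0\<close>.\<close>
    using eventually_gt_at_top[of 0]
  proof eventually_elim
    case (elim n)
    then show ?case
      using pos[of "real n"] pos[of "real (n + 1)"] by (simp add: ln_div)
  qed
  ultimately have "(\<lambda>n::nat. ln (h (real (n + 1))) - ln (h (real n))) \<longlonglongrightarrow> 0"
    by (rule Lim_transform_eventually)
  then have "ln (h (2 * x)) \<le> ln (h x)"
    using convex_on_increments_tendsto_0_imp_antimono log_convex x
    unfolding log_convex_on_def by fastforce
  then have "h (2 * x) \<le> h x"
    using pos[of x] pos[of "2 * x"] x by simp
  then show "norm (h x) \<le> (h x)\<^sup>2 / h (2 * x)"
    using pos[of x] pos[of "2 * x"] x by (simp add: field_simps power2_eq_square)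
qed

end
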